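(* Let $H$ be a commutative hemiring and let $\mathcal{P}(H)$ denote its power set, ordered by inclusion. Then the subtractive closure $\operatorname{scl}_H$ is a closure operator on $\mathcal{P}(H)$. Moreover, the following hold for all ideals $I$ and $J$ of $H$: (a) $\operatorname{scl}_H(I)=\{h \in H : h+i \in I \text{ for some } i \in I\}$. (b) $\operatorname{scl}_H(I)+\operatorname{scl}_H(J)\subseteq \operatorname{scl}_H(I+J)$. (c) $\operatorname{scl}_H(I \cap J)\subseteq \operatorname{scl}_H(I)\cap \operatorname{scl}_H(J)$. (d) $\operatorname{scl}_H(I)\operatorname{scl}_H(J) \subseteq \operatorname{scl}_H(IJ)$.
   Context: A (commutative) hemiring $(H,+,\cdot)$ is a set with $(H,+)$ a commutative monoid with identity $0$, $(H,\cdot)$ a commutative semigroup, multiplication distributing over addition, and $0h=0$ for all $h\in H$. No multiplicative identity is assumed. An ideal of $H$ is a nonempty subset $I$ with $a+b\in I$ and $ha\in I$ for all $a,b\in I$, $h\in H$. An ideal $I$ is subtractive if $x+y\in I$ and $x\in I$ imply $y\in I$, for all $x,y\in H$. For ideals $I,J$: $I+J=\{i+j: i\in I, j\in J\}$, and $IJ$ is the set of all finite sums of products $ij$ with $i\in I$, $j\in J$. For a subset $X\subseteq H$, the subtractive closure $\operatorname{scl}_H(X)$ is the intersection of all subtractive ideals of $H$ containing $X$. A closure operator on a partially ordered set $(P,\le)$ is a map $c:P\to P$ with $x\le c(x)$; $x\le y\Rightarrow c(x)\le c(y)$; and $c(c(x))=c(x)$, for all $x,y\in P$. *)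

theory Defs
  imports Main "HOL-Library.Set_Algebras"
begin

text \<open>
  A commutative hemiring is a type of class \<^class>\<open>comm_semiring_0\<close>: a commutative semiring
  with an absorbing zero and no multiplicative identity required. The set \<open>H\<close> is the whole type.
\<close>

definition is_ideal :: "'a::comm_semiring_0 set \<Rightarrow> bool" where
  "is_ideal I \<longleftrightarrow>
     I \<noteq> {} \<and> (\<forall>a\<in>I. \<forall>b\<in>I. a + b \<in> I) \<and> (\<forall>h. \<forall>a\<in>I. h * a \<in> I)"

definition subtractive :: "'a::comm_semiring_0 set \<Rightarrow> bool" where
  "subtractive I \<longleftrightarrow> (\<forall>x y. x + y \<in> I \<and> x \<in> I \<longrightarrow> y \<in> I)"

definition scl :: "'a::comm_semiring_0 set \<Rightarrow> 'a set" where
  "scl X = \<Inter> {I. is_ideal I \<and> subtractive I \<and> X \<subseteq> I}"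

text \<open>
  The product of ideals consists of finite sums of products, unlike the elementwise product
  \<open>I * J\<close> of \<^theory>\<open>HOL-Library.Set_Algebras\<close>. The sum of ideals is the elementwise
  \<open>I + J\<close> of that theory. The empty sum (\<open>n = 0\<close>) adds nothing when \<open>I\<close> and \<open>J\<close> are
  ideals, since then \<open>0 = 0 * 0\<close> is already a product of elements of \<open>I\<close> and \<open>J\<close>.
\<close>

definition ideal_prod :: "'a::comm_semiring_0 set \<Rightarrow> 'a set \<Rightarrow> 'a set" where
  "ideal_prod I J =
     {(\<Sum>k<n. f k * g k) | (n::nat) f g. \<forall>k<n. f k \<in> I \<and> g k \<in> J}"

definition closure_operator :: "('p::order \<Rightarrow> 'p) \<Rightarrow> bool" where
  "closure_operator c \<longleftrightarrow>
     (\<forall>x. x \<le> c x) \<and> (\<forall>x y. x \<le> y \<longrightarrow> c x \<le> c y) \<and> (\<forall>x. c (c x) = c x)"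

end

theory Submission
  imports Defs
begin

text \<open>Subtractive ideals are stable under intersection, so \<open>scl X\<close> is the least
  subtractive ideal containing \<open>X\<close>; the closure axioms follow at once, and (c) is
  monotonicity. For (a), \<open>scl_ideal_eq\<close> checks that the right-hand set is a subtractive
  ideal containing \<open>I\<close> and that subtractivity of \<open>scl I\<close> forces each of
  its elements into \<open>scl I\<close>. For (b), both closures lie in \<open>scl (I + J)\<close>,
  which is closed under addition. For (d), \<open>ideal_prod_scl_subset\<close> passes from
  \<open>I\<close> and \<open>J\<close> to their closures one factor at a time, using that colons of
  subtractive ideals are subtractive ideals.\<close>

lemma ideal_add: "is_ideal I \<Longrightarrow> a \<in> I \<Longrightarrow> b \<in> I \<Longrightarrow> a + b \<in> I"
  by (simp add: is_ideal_def)

lemma ideal_mult: "is_ideal I \<Longrightarrow> a \<in> I \<Longrightarrow> h * a \<in> I"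
  by (simp add: is_ideal_def)

lemma ideal_zero:
  assumes "is_ideal I"
  shows "0 \<in> I"
proof -
  obtain a where "a \<in> I"
    using assms by (auto simp: is_ideal_def)
  then have "0 * a \<in> I"
    by (rule ideal_mult[OF assms])
  then show ?thesis by simp
qed

text \<open>An infinite \<open>A\<close> is harmless: its sum is 0 by convention, and 0 lies in
  every ideal.\<close>

lemma ideal_sum:
  assumes "is_ideal I" and "\<And>k. k \<in> A \<Longrightarrow> f k \<in> I"
  shows "sum f A \<in> I"
  using assms(2)
  by (induction A rule: infinite_finite_induct)
    (auto simp: ideal_zero[OF assms(1)] intro: ideal_add[OF assms(1)])

lemma is_idealI:
  assumes "0 \<in> I" and "\<And>a b. a \<in> I \<Longrightarrow> b \<in> I \<Longrightarrow> a + b \<in> I"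
    and "\<And>h a. a \<in> I \<Longrightarrow> h * a \<in> I"
  shows "is_ideal I"
  using assms unfolding is_ideal_def by blast

lemma subtractiveD: "subtractive I \<Longrightarrow> x + y \<in> I \<Longrightarrow> x \<in> I \<Longrightarrow> y \<in> I"
  unfolding subtractive_def by blast

lemma subset_scl: "X \<subseteq> scl X"
  unfolding scl_def by blast

lemma scl_least: "is_ideal I \<Longrightarrow> subtractive I \<Longrightarrow> X \<subseteq> I \<Longrightarrow> scl X \<subseteq> I"
  unfolding scl_def by blast

text \<open>The intersection is nonempty because every ideal contains 0.\<close>

lemma is_ideal_scl: "is_ideal (scl X)"
  by (rule is_idealI) (auto simp: scl_def ideal_zero ideal_add ideal_mult)

lemma subtractive_scl: "subtractive (scl X)"
  unfolding scl_def subtractive_def by blast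

lemma scl_mono: "X \<subseteq> Y \<Longrightarrow> scl X \<subseteq> scl Y"
  by (meson is_ideal_scl order_trans scl_least subset_scl subtractive_scl)

lemma scl_scl: "scl (scl X) = scl X"
  by (simp add: equalityI is_ideal_scl scl_least subset_scl subtractive_scl)

lemma closure_operator_scl: "closure_operator scl"
  by (simp add: closure_operator_def subset_scl scl_mono scl_scl)

lemma scl_ideal_eq:
  assumes I: "is_ideal I"
  shows "scl I = {h. \<exists>i\<in>I. h + i \<in> I}" (is "_ = ?S")
proof
  have "is_ideal ?S"
  proof (rule is_idealI)
    show "0 \<in> ?S"
      using ideal_zero[OF I] by force
  next
    fix a b assume "a \<in> ?S" "b \<in> ?S"
    then obtain i j where "i \<in> I" "a + i \<in> I" "j \<in> I" "b + j \<in> I" by blast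
    then have "i + j \<in> I" "(a + i) + (b + j) \<in> I"
      by (simp_all add: ideal_add[OF I])
    moreover have "(a + i) + (b + j) = (a + b) + (i + j)"
      by (simp add: ac_simps)
    ultimately show "a + b \<in> ?S"
      by auto
  next
    fix h a assume "a \<in> ?S"
    then obtain i where "i \<in> I" "a + i \<in> I" by blast
    then have "h * i \<in> I" "h * (a + i) \<in> I"
      by (simp_all add: ideal_mult[OF I])
    then show "h * a \<in> ?S"
      by (auto simp: distrib_left)
  qed
  moreover have "subtractive ?S"
    unfolding subtractive_def
  proof (intro allI impI)
    fix x y assume "x + y \<in> ?S \<and> x \<in> ?S"
    then obtain i j where "i \<in> I" "x + y + i \<in> I" "j \<in> I" "x + j \<in> I" by blast
    \<comment> \<open>The witness for \<open>y\<close> is \<open>x + j + i\<close>: adding it to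
      \<open>y\<close> regroups to \<open>(x + y + i) + j\<close>, a sum of two elements of
      \<open>I\<close>.\<close>
    then have "(x + j) + i \<in> I" "(x + y + i) + j \<in> I"
      by (simp_all add: ideal_add[OF I])
    moreover have "(x + y + i) + j = y + ((x + j) + i)"
      by (simp add: ac_simps)
    ultimately show "y \<in> ?S"
      by auto
  qed
  moreover have "I \<subseteq> ?S"
    by (auto intro: ideal_add[OF I])
  ultimately show "scl I \<subseteq> ?S"
    by (rule scl_least)
  show "?S \<subseteq> scl I"
  proof
    fix h assume "h \<in> ?S"
    then obtain i where "i \<in> I" "h + i \<in> I" by blast
    then have "i + h \<in> scl I" "i \<in> scl I"
      using subset_scl[of I] by (auto simp: add.commute)
    then show "h \<in> scl I"
      by (rule subtractiveD[OF subtractive_scl])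
  qed
qed

text \<open>The zeros embed each summand in \<open>I + J\<close>, so monotonicity applies to
  both.\<close>

lemma scl_plus_subset:
  assumes "0 \<in> I" "0 \<in> J"
  shows "scl I + scl J \<subseteq> scl (I + J)"
proof -
  have "I \<subseteq> I + J" "J \<subseteq> I + J"
    using assms by (force simp: set_plus_def)+
  then have "scl I \<subseteq> scl (I + J)" "scl J \<subseteq> scl (I + J)"
    by (simp_all add: scl_mono)
  then show ?thesis
    by (auto simp: set_plus_def intro: ideal_add[OF is_ideal_scl])
qed

text \<open>The colon set is the preimage of \<open>K\<close> under multiplication by
  \<open>y\<close>, an additive map that commutes with multiplication by elements of the
  hemiring.\<close>

lemma is_ideal_colon: "is_ideal K \<Longrightarrow> is_ideal {x. x * y \<in> K}"
  by (rule is_idealI) (simp_all add: ideal_zero distrib_right ideal_add mult.assoc ideal_mult)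

lemma subtractive_colon: "subtractive K \<Longrightarrow> subtractive {x. x * y \<in> K}"
  unfolding subtractive_def mem_Collect_eq distrib_right by blast

lemma mult_mem_ideal_prod:
  assumes "x \<in> I" "y \<in> J"
  shows "x * y \<in> ideal_prod I J"
  unfolding ideal_prod_def mem_Collect_eq
  by (rule exI[of _ "Suc 0"], rule exI[of _ "\<lambda>_. x"], rule exI[of _ "\<lambda>_. y"])
    (simp add: assms)

text \<open>
  The colon sets \<open>{x. x * y \<in> scl (IJ)}\<close> are subtractive ideals. Hence membership of \<open>x * y\<close>
  extends from \<open>I\<close> to \<open>scl I\<close> for fixed \<open>y\<close> in \<open>J\<close>, and then from \<open>J\<close> to \<open>scl J\<close> for fixed
  \<open>x\<close> in \<open>scl I\<close>.
\<close>
lemma ideal_prod_scl_subset: "ideal_prod (scl I) (scl J) \<subseteq> scl (ideal_prod I J)"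
proof -
  let ?K = "scl (ideal_prod I J)"
  have colon: "scl X \<subseteq> {x. x * y \<in> ?K}" if "X \<subseteq> {x. x * y \<in> ?K}" for X y
    using that by (intro scl_least is_ideal_colon subtractive_colon is_ideal_scl subtractive_scl)
  have "scl I \<subseteq> {x. x * y \<in> ?K}" if "y \<in> J" for y
    using that mult_mem_ideal_prod subset_scl by (intro colon) blast
  \<comment> \<open>Writing the product as \<open>y * x\<close> lets the same \<open>colon\<close>
    fact act on the second factor.\<close>
  then have "scl J \<subseteq> {y. y * x \<in> ?K}" if "x \<in> scl I" for x
    using that by (intro colon) (auto simp: mult.commute)
  then have "x * y \<in> ?K" if "x \<in> scl I" "y \<in> scl J" for x y
    using that by (auto simp: mult.commute)
  then show ?thesis
    by (auto simp: ideal_prod_def intro!: ideal_sum[OF is_ideal_scl])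
qed

theorem theorem2p4:
  shows "closure_operator (scl :: 'a::comm_semiring_0 set \<Rightarrow> 'a set) \<and>
    (\<forall>I J :: 'a set. is_ideal I \<and> is_ideal J \<longrightarrow>
       scl I = {h. \<exists>i\<in>I. h + i \<in> I} \<and>
       scl I + scl J \<subseteq> scl (I + J) \<and>
       scl (I \<inter> J) \<subseteq> scl I \<inter> scl J \<and>
       ideal_prod (scl I) (scl J) \<subseteq> scl (ideal_prod I J))"
  by (intro conjI allI impI closure_operator_scl scl_ideal_eq scl_plus_subset
      ideal_prod_scl_subset Int_greatest scl_mono) (simp_all add: ideal_zero)

end
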